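(* Let $(D,G_o)$ be a two-sender unicast index-coding problem, with arbitrary (fully or partially participated) interaction between its sub-digraphs $D_1,D_2,D_3$. Suppose that the three-vertex digraph $f(D)$ is either acyclic (no directed cycle, where a pair of opposite arcs counts as a directed cycle) or has no arc going out of vertex $3$. Then the arcs of $D$ between $D_1,D_2$ and $D_3$ (i.e. arcs from a vertex of $D_i$ to a vertex of $D_j$ with $i\ne j$) are not critical in the asymptotic regime: removing such an arc from $D$ does not strictly increase $\beta(D,G_o)$.
   Context: There are $N$ messages $\mathcal{M}=\{x_1,\dots,x_N\}$, $x_i\in\{0,1\}^t$, and $N$ receivers; receiver $r$ requests $x_r$ and knows $\{x_j: j\in N_D^+(r)\}$, where $D$ is a loopless digraph on $V(D)=\{1,\dots,N\}$ (the side-information digraph) and $N_D^+(r)$ is the out-neighborhood of $r$. Senders $S_1,S_2$ know $\mathcal{M}_1,\mathcal{M}_2$ with $\mathcal{M}_1\cup\mathcal{M}_2=\mathcal{M}$. A two-sender index code consists of encoding functions $\mathscr{F}_s:\{0,1\}^{|\mathcal{M}_s|t}\to\{0,1\}^{p_s}$, $s=1,2$ ($p_s\ge0$ an integer), and decoding functions by which every receiver $r$ recovers $x_r$, for all message realizations, from both sub-codewords and its side information. $\beta_t(D,G_o)$ is the minimum of $(p_1+p_2)/t$ over two-sender index codes for $t$-bit messages, and $\beta(D,G_o)=\inf_t\beta_t(D,G_o)=\lim_{t\to\infty}\beta_t(D,G_o)$. Here $G_o$ (the sender-constraint graph, with vertex set $V(D)$ and an edge $ij$ iff one of $x_i,x_j$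 is in $\mathcal{M}_1\setminus\mathcal{M}_2$ and the other in $\mathcal{M}_2\setminus\mathcal{M}_1$) records the senders' message sets. Let $\mathcal{P}_1=\mathcal{M}_1\setminus\mathcal{M}_2$, $\mathcal{P}_2=\mathcal{M}_2\setminus\mathcal{M}_1$, $\mathcal{P}_3=\mathcal{M}_1\cap\mathcal{M}_2$. For $i\in\{1,2,3\}$, $D_i$ is the sub-digraph of $D$ induced by $\{j:x_j\in\mathcal{P}_i\}$. The digraph $f(D)$ has vertex set $\{1,2,3\}$, and $(i,j)$, $i\neq j$, is an arc of $f(D)$ iff there is an arc of $D$ from some vertex of $D_i$ to some vertex of $D_j$. The interaction is called fully participated if, whenever $(i,j)$ is an arc of $f(D)$, every vertex of $D_i$ has arcs to all vertices of $D_j$; otherwise it is partially participated. An arc is critical if removing it strictly increases the optimal broadcast rate. *)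

theory Defs
  imports Complex_Main "HOL-Library.FuncSet"
begin

text \<open>
  A problem instance is given by the number of messages \<open>N\<close>, the side-information digraph \<open>D\<close>,
  as an arc relation on the vertex set \<open>{1..N}\<close>, and the index sets \<open>M1\<close>, \<open>M2\<close> of the messages
  known to the two senders, which the sender-constraint graph \<open>G\<^sub>o\<close> records.
  The out-neighborhood of \<open>r\<close> is \<open>D `` {r}\<close>.
\<close>

definition words :: "nat \<Rightarrow> bool list set" where
  "words n = {w. length w = n}"

text \<open>
  The encoder of a sender and the decoder of a receiver are given only the restriction of the
  message tuple to the messages that this sender or receiver knows.
\<close>

definition two_sender_index_code ::
  "nat \<Rightarrow> nat rel \<Rightarrow> nat set \<Rightarrow> nat set \<Rightarrow> nat \<Rightarrow> nat \<Rightarrow> nat \<Rightarrow>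
   ((nat \<Rightarrow> bool list) \<Rightarrow> bool list) \<Rightarrow> ((nat \<Rightarrow> bool list) \<Rightarrow> bool list) \<Rightarrow>
   (nat \<Rightarrow> bool list \<Rightarrow> bool list \<Rightarrow> (nat \<Rightarrow> bool list) \<Rightarrow> bool list) \<Rightarrow> bool" where
  "two_sender_index_code N D M1 M2 t p1 p2 F1 F2 G \<longleftrightarrow>
     F1 \<in> (M1 \<rightarrow>\<^sub>E words t) \<rightarrow> words p1 \<and>
     F2 \<in> (M2 \<rightarrow>\<^sub>E words t) \<rightarrow> words p2 \<and>
     (\<forall>x \<in> {1..N} \<rightarrow>\<^sub>E words t. \<forall>r \<in> {1..N}.
        G r (F1 (restrict x M1)) (F2 (restrict x M2)) (restrict x (D `` {r})) = x r)"

text \<open>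
  The least total codeword length is attained, since it is a least natural number and sending
  all messages uncoded is a code whenever \<open>M1 \<union> M2 = {1..N}\<close>.
\<close>

definition broadcast_rate_t ::
  "nat \<Rightarrow> nat rel \<Rightarrow> nat set \<Rightarrow> nat set \<Rightarrow> nat \<Rightarrow> real" where
  "broadcast_rate_t N D M1 M2 t =
     real (LEAST p. \<exists>p1 p2 F1 F2 G. p = p1 + p2 \<and>
                      two_sender_index_code N D M1 M2 t p1 p2 F1 F2 G) / real t"

definition broadcast_rate :: "nat \<Rightarrow> nat rel \<Rightarrow> nat set \<Rightarrow> nat set \<Rightarrow> real" where
  "broadcast_rate N D M1 M2 = (INF t \<in> {1..}. broadcast_rate_t N D M1 M2 t)"

definition message_part :: "nat set \<Rightarrow> nat set \<Rightarrow> nat \<Rightarrow> nat set" where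
  "message_part M1 M2 i =
     (if i = 1 then M1 - M2 else if i = 2 then M2 - M1 else if i = 3 then M1 \<inter> M2 else {})"

text \<open>The arc set of the digraph \<open>f(D)\<close> on the vertex set \<open>{1, 2, 3}\<close>.\<close>

definition interaction_digraph :: "nat rel \<Rightarrow> nat set \<Rightarrow> nat set \<Rightarrow> nat rel" where
  "interaction_digraph D M1 M2 =
     {(i, j). i \<in> {1, 2, 3} \<and> j \<in> {1, 2, 3} \<and> i \<noteq> j \<and>
        (\<exists>u \<in> message_part M1 M2 i. \<exists>v \<in> message_part M1 M2 j. (u, v) \<in> D)}"

definition critical_arc :: "nat \<Rightarrow> nat rel \<Rightarrow> nat set \<Rightarrow> nat set \<Rightarrow> nat \<times> nat \<Rightarrow> bool" where
  "critical_arc N D M1 M2 a \<longleftrightarrow>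
     a \<in> D \<and> broadcast_rate N D M1 M2 < broadcast_rate N (D - {a}) M1 M2"

end

theory Submission
  imports Defs "HOL-Real_Asymp.Real_Asymp"
begin

text \<open>
  Call a set of message tuples on a part \<open>P\<close> of the vertices independent if no receiver in \<open>P\<close>,
  given its side information inside \<open>P\<close>, can confuse two of its elements, and let \<open>\<alpha>(P)\<close> be the
  largest size of such a set. Under either hypothesis on \<open>f(D)\<close>, the tuples that share a fixed
  codeword can be counted one part at a time, conditioning on the parts already treated: each part
  contributes at most \<open>\<alpha>(P\<^sub>i)\<close>, so \<open>2\<^bsup>tN\<^esup> \<le> 2\<^bsup>p\<^sub>1 + p\<^sub>2\<^esup> \<alpha>(P\<^sub>1) \<alpha>(P\<^sub>2) \<alpha>(P\<^sub>3)\<close>. When part 3 has no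
  outgoing arcs, this uses that for fixed \<open>x\<^sub>3\<close> the set of \<open>(x\<^sub>1, x\<^sub>2)\<close> with a fixed codeword is a
  product. Conversely, independence is invariant under translation by XOR, so greedily chosen
  translates of a largest independent set cover all tuples on \<open>P\<^sub>i\<close> with only a factor
  \<open>O(t)\<close> more sets than the ratio \<open>2\<^bsup>t|P\<^sub>i|\<^esup> / \<alpha>(P\<^sub>i)\<close>. Coding the parts separately therefore
  loses \<open>O(log t)\<close> bits, and uses no arc between the parts. Subadditivity of the optimal codeword
  length in \<open>t\<close> makes this loss vanish in the limit.
\<close>

section \<open>Words and XOR\<close>

definition xor_word :: "bool list \<Rightarrow> bool list \<Rightarrow> bool list" where
  "xor_word v w = map2 (\<noteq>) v w"

lemma xor_word_in_words: "v \<in> words n \<Longrightarrow> w \<in> words n \<Longrightarrow> xor_word v w \<in> words n"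
  by (simp add: xor_word_def words_def)

lemma xor_word_cancel:
  assumes "v \<in> words n" "w \<in> words n"
  shows "xor_word v (xor_word w v) = w" "xor_word w (xor_word w v) = v"
  using assms by (auto simp: xor_word_def words_def intro!: nth_equalityI)

lemma xor_word_right_inject:
  assumes "v \<in> words n" "v' \<in> words n" "w \<in> words n"
  shows "xor_word v w = xor_word v' w \<longleftrightarrow> v = v'"
proof -
  have "xor_word (xor_word u w) w = u" if "u \<in> words n" for u
    using that assms(3) by (auto simp: xor_word_def words_def intro!: nth_equalityI)
  then show ?thesis using assms by metis
qed

lemma finite_words: "finite (words n)"
  using finite_lists_length_eq[of "UNIV :: bool set" n] by (simp add: words_def)

lemma card_words: "card (words n) = 2 ^ n"
  using card_lists_length_eq[of "UNIV :: bool set" n] by (simp add: words_def)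

lemma finite_tuples: "finite P \<Longrightarrow> finite (P \<rightarrow>\<^sub>E words t)"
  by (intro finite_PiE finite_words)

lemma card_tuples: "finite P \<Longrightarrow> card (P \<rightarrow>\<^sub>E words t) = 2 ^ (t * card P)"
  by (simp add: card_PiE card_words power_mult)

section \<open>Independent sets of message tuples\<close>

text \<open>The negation is adjacency in the confusion graph of the sub-digraph induced by
  \<open>P\<close>: some receiver in \<open>P\<close> sees equal side information inside
  \<open>P\<close> but wants different messages.\<close>

definition distinguishable ::
  "nat rel \<Rightarrow> nat set \<Rightarrow> (nat \<Rightarrow> bool list) \<Rightarrow> (nat \<Rightarrow> bool list) \<Rightarrow> bool" where
  "distinguishable D P x y \<longleftrightarrow>
     (\<forall>r\<in>P. (\<forall>s\<in>P. (r, s) \<in> D \<longrightarrow> x s = y s) \<longrightarrow> x r = y r)"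

definition independent_tuples ::
  "nat rel \<Rightarrow> nat set \<Rightarrow> nat \<Rightarrow> (nat \<Rightarrow> bool list) set \<Rightarrow> bool" where
  "independent_tuples D P t S \<longleftrightarrow>
     S \<subseteq> (P \<rightarrow>\<^sub>E words t) \<and> (\<forall>x\<in>S. \<forall>y\<in>S. distinguishable D P x y)"

definition independence_number :: "nat rel \<Rightarrow> nat set \<Rightarrow> nat \<Rightarrow> nat" where
  "independence_number D P t = Max (card ` {S. independent_tuples D P t S})"

lemma distinguishable_restrict:
  "distinguishable D P (restrict x P) (restrict y P) \<longleftrightarrow> distinguishable D P x y"
  by (simp add: distinguishable_def)

lemma finite_independent_tuples:
  assumes "finite P"
  shows "finite {S. independent_tuples D P t S}"
  by (rule finite_subset[of _ "Pow (P \<rightarrow>\<^sub>E words t)"])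
    (auto simp: independent_tuples_def finite_tuples assms)

lemma card_le_independence_number:
  assumes "finite P" "independent_tuples D P t S"
  shows "card S \<le> independence_number D P t"
  unfolding independence_number_def using assms finite_independent_tuples by (intro Max_ge) auto

lemma independence_number_attained:
  assumes "finite P"
  obtains S where "independent_tuples D P t S" "card S = independence_number D P t"
proof -
  have "independent_tuples D P t {}" by (simp add: independent_tuples_def)
  then have "independence_number D P t \<in> card ` {S. independent_tuples D P t S}"
    unfolding independence_number_def
    using finite_independent_tuples[OF assms] by (intro Max_in) auto
  then show ?thesis using that by auto
qed

lemma independence_number_pos:
  assumes "finite P"
  shows "independence_number D P t > 0"
proof -
  have "independent_tuples D P t {\<lambda>r\<in>P. replicate t True}"
    by (auto simp: independent_tuples_def distinguishable_def words_def)
  from card_le_independence_number[OF assms this] show ?thesis by simp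
qed

section \<open>Counting the tuples with a given codeword\<close>

lemma card_restrict_le_independence_number:
  assumes "finite P" "\<And>x. x \<in> B \<Longrightarrow> x \<in> P \<rightarrow> words t"
    and "\<And>x y. x \<in> B \<Longrightarrow> y \<in> B \<Longrightarrow> distinguishable D P x y"
  shows "card ((\<lambda>x. restrict x P) ` B) \<le> independence_number D P t"
  using assms
  by (intro card_le_independence_number)
    (auto simp: independent_tuples_def distinguishable_restrict Pi_iff)

text \<open>Grouping \<open>B\<close> by the values on \<open>P\<close> gives at most
  \<open>a\<close> classes, and inside a class a tuple on \<open>P \<union> Q\<close> is determined
  by its values on \<open>Q\<close>.\<close>

lemma card_restrict_Un_le:
  fixes B :: "('a \<Rightarrow> 'b) set"
  assumes "finite B"
    and "card ((\<lambda>x. restrict x P) ` B) \<le> a"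
    and "\<And>z. card ((\<lambda>x. restrict x Q) ` {x \<in> B. restrict x P = z}) \<le> b"
  shows "card ((\<lambda>x. restrict x (P \<union> Q)) ` B) \<le> a * b"
proof -
  let ?Z = "(\<lambda>x. restrict x P) ` B"
  let ?B = "\<lambda>z. {x \<in> B. restrict x P = z}"
  have "(\<lambda>x. restrict x (P \<union> Q)) ` B = (\<Union>z\<in>?Z. (\<lambda>x. restrict x (P \<union> Q)) ` ?B z)"
    by auto
  also have "card \<dots> \<le> (\<Sum>z\<in>?Z. card ((\<lambda>x. restrict x (P \<union> Q)) ` ?B z))"
    using assms(1) by (intro card_UN_le) auto
  also have "\<dots> \<le> (\<Sum>z\<in>?Z. b)"
  proof (rule sum_mono)
    fix z :: "'a \<Rightarrow> 'b"
    let ?f = "\<lambda>y. restrict (\<lambda>r. if r \<in> P then z r else y r) (P \<union> Q)"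
    have "restrict x (P \<union> Q) = ?f (restrict x Q)" if "x \<in> ?B z" for x
      using that by auto
    then have "(\<lambda>x. restrict x (P \<union> Q)) ` ?B z = ?f ` (\<lambda>x. restrict x Q) ` ?B z"
      unfolding image_image by (intro image_cong) auto
    also have "card \<dots> \<le> card ((\<lambda>x. restrict x Q) ` ?B z)"
      using assms(1) by (intro card_image_le) auto
    finally show "card ((\<lambda>x. restrict x (P \<union> Q)) ` ?B z) \<le> b"
      using assms(3)[of z] by (rule order_trans)
  qed
  also have "\<dots> \<le> a * b"
    using assms(2) by simp
  finally show ?thesis .
qed

text \<open>The class count is applied twice, so \<open>Q\<close> is examined only among tuples
  agreeing on \<open>P\<close>, and \<open>R\<close> only among tuples agreeing on
  \<open>P \<union> Q\<close>. The order of the parts decides what is conditioned on.\<close>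

lemma card_le_prod_independence_numbers:
  assumes fin: "finite (P \<union> Q \<union> R)"
    and B: "B \<subseteq> (P \<union> Q \<union> R) \<rightarrow>\<^sub>E words t"
    and P: "\<And>x y. x \<in> B \<Longrightarrow> y \<in> B \<Longrightarrow> distinguishable D P x y"
    and Q: "\<And>x y. x \<in> B \<Longrightarrow> y \<in> B \<Longrightarrow> \<forall>s\<in>P. x s = y s \<Longrightarrow> distinguishable D Q x y"
    and R: "\<And>x y. x \<in> B \<Longrightarrow> y \<in> B \<Longrightarrow> \<forall>s\<in>P \<union> Q. x s = y s \<Longrightarrow> distinguishable D R x y"
  shows "card B \<le> independence_number D P t * independence_number D Q t *
                  independence_number D R t"
proof -
  have finB: "finite B"
    using finite_subset[OF B finite_tuples[OF fin]] .
  have agree: "\<forall>s\<in>A. x s = y s" if "restrict y A = restrict x A"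
    for A and x y :: "nat \<Rightarrow> bool list"
    using that by (metis restrict_apply')
  have vals: "x \<in> P \<rightarrow> words t" "x \<in> Q \<rightarrow> words t" "x \<in> R \<rightarrow> words t" if "x \<in> B" for x
    using that B by (auto simp: PiE_def Pi_def subset_eq)
  have PQ: "card ((\<lambda>x. restrict x (P \<union> Q)) ` B) \<le> independence_number D P t * independence_number D Q t"
    using fin finB
    by (intro card_restrict_Un_le card_restrict_le_independence_number)
      (auto dest: vals intro: P intro!: Q dest!: agree)
  have "card ((\<lambda>x. restrict x ((P \<union> Q) \<union> R)) ` B) \<le>
      (independence_number D P t * independence_number D Q t) * independence_number D R t"
    using fin
    by (intro card_restrict_Un_le[OF finB PQ] card_restrict_le_independence_number)
      (auto dest: vals intro!: R dest!: agree)
  moreover have "(\<lambda>x. restrict x ((P \<union> Q) \<union> R)) ` B = (\<lambda>x. x) ` B"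
    using B by (intro image_cong) (auto intro!: PiE_restrict)
  ultimately show ?thesis by simp
qed

section \<open>Covering by independent sets\<close>

text \<open>Double counting of the pairs \<open>(u, z)\<close> with \<open>u \<in> A z\<close>:
  every \<open>u\<close> lies in at least \<open>K\<close> of the sets, so some set covers at least
  the share \<open>K / card Z\<close> of \<open>U\<close>.\<close>

lemma exists_good_cover_member:
  fixes A :: "'z \<Rightarrow> 'a set"
  assumes "finite U" "finite Z" "Z \<noteq> {}"
    and K: "\<And>u. u \<in> U \<Longrightarrow> K \<le> card {z \<in> Z. u \<in> A z}"
  obtains z where "z \<in> Z" "real (card (U - A z)) \<le> real (card U) * (1 - real K / real (card Z))"
proof -
  have "\<exists>z\<in>Z. real (card U) * K / card Z \<le> card (U \<inter> A z)"
  proof (rule ccontr)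
    assume neg: "\<not> ?thesis"
    have "real (card U) * K = (\<Sum>u\<in>U. real K)" by simp
    also have "\<dots> \<le> (\<Sum>u\<in>U. real (card {z \<in> Z. u \<in> A z}))"
      using K by (intro sum_mono) simp
    also have "\<dots> = (\<Sum>u\<in>U. \<Sum>z\<in>Z. if u \<in> A z then 1 else 0)"
      using assms(2) by (intro sum.cong) (auto simp: sum.If_cases Int_def)
    also have "\<dots> = (\<Sum>z\<in>Z. \<Sum>u\<in>U. if u \<in> A z then 1 else 0)"
      by (rule sum.swap)
    also have "\<dots> = (\<Sum>z\<in>Z. real (card (U \<inter> A z)))"
      using assms(1) by (intro sum.cong) (auto simp: sum.If_cases)
    also have "\<dots> < (\<Sum>z\<in>Z. real (card U) * K / card Z)"
      using neg assms(2,3) by (intro sum_strict_mono) (auto simp: not_le)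
    also have "\<dots> = real (card U) * K"
      using assms(2,3) by simp
    finally show False by simp
  qed
  then obtain z where z: "z \<in> Z" "real (card U) * K / card Z \<le> card (U \<inter> A z)" by blast
  have "real (card U) = card (U - A z) + card (U \<inter> A z)"
    using card_Int_Diff[OF assms(1), of "A z"] by simp
  with z show ?thesis by (intro that[of z]) (simp_all add: right_diff_distrib)
qed

text \<open>Greedy choice: each new set leaves at most the fraction \<open>1 - K / card Z\<close> of
  what was still uncovered, so the uncovered part decays geometrically.\<close>

lemma exists_partial_cover:
  fixes A :: "'z \<Rightarrow> 'a set"
  assumes X: "finite X" and Z: "finite Z" "Z \<noteq> {}"
    and K: "\<And>u. u \<in> X \<Longrightarrow> K \<le> card {z \<in> Z. u \<in> A z}" and le: "K \<le> card Z"
  shows "\<exists>f :: nat \<Rightarrow> 'z. (\<forall>i. f i \<in> Z) \<and>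
           real (card (X - (\<Union>i<m. A (f i)))) \<le> real (card X) * (1 - real K / real (card Z)) ^ m"
proof (induction m)
  case 0
  then show ?case using Z by auto
next
  case (Suc m)
  then obtain f where f: "\<forall>i::nat. f i \<in> Z"
    "real (card (X - (\<Union>i<m. A (f i)))) \<le> real (card X) * (1 - real K / real (card Z)) ^ m"
    by blast
  let ?U = "X - (\<Union>i<m. A (f i))"
  obtain z where z: "z \<in> Z" "real (card (?U - A z)) \<le> real (card ?U) * (1 - real K / real (card Z))"
    by (rule exists_good_cover_member[of ?U Z K A]) (use X Z K in auto)
  have "?U - A z = X - (\<Union>i<Suc m. A ((f(m := z)) i))"
    by (auto simp: lessThan_Suc)
  moreover have "real (card ?U) * (1 - real K / real (card Z))
      \<le> (real (card X) * (1 - real K / real (card Z)) ^ m) * (1 - real K / real (card Z))"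
    using f(2) le by (intro mult_right_mono) (auto simp: divide_le_eq_1)
  ultimately have "real (card (X - (\<Union>i<Suc m. A ((f(m := z)) i)))) \<le>
      real (card X) * (1 - real K / real (card Z)) ^ Suc m"
    using z(2) by (simp only: power_Suc2 mult.assoc)
  then show ?case using f(1) z(1) by (intro exI[of _ "f(m := z)"]) auto
qed

text \<open>With density \<rho> = \<open>K / card Z\<close>, the greedy choice leaves at most
  \<open>card X * exp (- \<rho> * m)\<close> elements. Once \<open>m\<close> exceeds
  \<open>ln (card X) / \<rho>\<close> this is below 1, so nothing is left.\<close>

lemma exists_cover:
  fixes A :: "'z \<Rightarrow> 'a set"
  assumes X: "finite X" "X \<noteq> {}" and Z: "finite Z" "Z \<noteq> {}" and "K > 0"
    and K: "\<And>u. u \<in> X \<Longrightarrow> K \<le> card {z \<in> Z. u \<in> A z}"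
  obtains m and f :: "nat \<Rightarrow> 'z" where "m > 0" "real m \<le> real (card Z) / K * (ln (card X) + 1)"
    "\<And>i. f i \<in> Z" "X \<subseteq> (\<Union>i<m. A (f i))"
proof -
  obtain u where "u \<in> X" using X by blast
  then have le: "K \<le> card Z"
    using K[of u] card_mono[OF Z(1), of "{z \<in> Z. u \<in> A z}"] by auto
  define \<rho> where "\<rho> = real K / card Z"
  have \<rho>: "0 < \<rho>" "\<rho> \<le> 1" using le \<open>K > 0\<close> by (auto simp: \<rho>_def)
  have X1: "card X \<ge> 1" using X by (simp add: Suc_le_eq card_gt_0_iff)
  \<comment> \<open>The floor plus one makes \<open>m\<close> strictly larger than the quotient,
    which is what pushes the uncovered count below 1.\<close>
  define m where "m = nat \<lfloor>ln (card X) / \<rho>\<rfloor> + 1"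
  have ln0: "ln (real (card X)) \<ge> 0" using X1 by simp
  have m1: "ln (card X) / \<rho> < m" unfolding m_def by linarith
  have "real m \<le> ln (card X) / \<rho> + 1"
    unfolding m_def using ln0 \<rho> by simp
  \<comment> \<open>The density is at most 1, so the rounding is absorbed into a multiple of
    \<open>1 / \<rho>\<close>.\<close>
  also have "\<dots> \<le> ln (card X) / \<rho> + 1 / \<rho>" using \<rho> by simp
  also have "\<dots> = real (card Z) / K * (ln (card X) + 1)"
    by (simp add: \<rho>_def add_divide_distrib distrib_left mult.commute)
  finally have m2: "real m \<le> real (card Z) / K * (ln (card X) + 1)" .
  obtain f where f: "\<forall>i::nat. f i \<in> Z"
    "real (card (X - (\<Union>i<m. A (f i)))) \<le> real (card X) * (1 - \<rho>) ^ m"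
    using exists_partial_cover[OF X(1) Z K le, of m] unfolding \<rho>_def by blast
  have "(1 - \<rho>) ^ m \<le> exp (- \<rho>) ^ m"
    using \<rho> exp_ge_add_one_self[of "- \<rho>"] by (intro power_mono) auto
  also have "\<dots> = exp (- (\<rho> * m))" by (simp add: exp_of_nat_mult[symmetric] mult.commute)
  also have "\<dots> < exp (- ln (card X))"
    using m1 \<rho> by (simp add: field_simps)
  also have "\<dots> = 1 / card X" using X1 by (simp add: exp_minus field_simps)
  finally have "real (card X) * (1 - \<rho>) ^ m < 1" using X1 by (simp add: field_simps)
  with f(2) have "card (X - (\<Union>i<m. A (f i))) = 0" by simp
  then have "X \<subseteq> (\<Union>i<m. A (f i))" using X by auto
  moreover have "m > 0" by (simp add: m_def)
  ultimately show ?thesis using that m2 f(1) by blast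
qed

section \<open>Coloring the confusion graph by XOR translates\<close>

lemma exists_power_two_between:
  fixes m :: nat
  assumes "m > 0"
  obtains q :: nat where "m \<le> 2 ^ q" "2 ^ q \<le> 2 * m"
proof (cases "m = 1")
  case True
  then show ?thesis using that[of 0] by simp
next
  case False
  with assms obtain n where "2 ^ n \<le> m" "m < 2 ^ (n + 1)"
    using ex_power_ivl1[of 2 m] by auto
  then show ?thesis using that[of "n + 1"] by simp
qed

text \<open>XOR with a fixed word is injective in every coordinate, so a translation preserves and
  reflects the equalities \<open>x r = y r\<close> on which confusion depends.\<close>

lemma independent_translate:
  assumes S: "independent_tuples D P t S" and z: "z \<in> P \<rightarrow>\<^sub>E words t"
  shows "independent_tuples D P t ((\<lambda>x. \<lambda>r\<in>P. xor_word (x r) (z r)) ` S)"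
proof -
  let ?tr = "\<lambda>x. \<lambda>r\<in>P. xor_word (x r) (z r)"
  have w: "x r \<in> words t" "z r \<in> words t" if "x \<in> S" "r \<in> P" for x r
    using S z that by (auto simp: independent_tuples_def)
  have "?tr x r = ?tr y r \<longleftrightarrow> x r = y r" if "x \<in> S" "y \<in> S" "r \<in> P" for x y r
    using that xor_word_right_inject[OF w(1) w(1) w(2)] by simp
  then have "distinguishable D P (?tr x) (?tr y)" if "x \<in> S" "y \<in> S" for x y
    using S that unfolding independent_tuples_def distinguishable_def by metis
  moreover have "?tr ` S \<subseteq> P \<rightarrow>\<^sub>E words t"
    using w xor_word_in_words by auto
  ultimately show ?thesis
    unfolding independent_tuples_def by blast
qed

text \<open>Each tuple is colored by a translate of a largest independent set that contains it.
  Every tuple lies in many translates, so the greedy cover needs few of them; the factor 2 pays for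
  rounding their number up to a power of two.\<close>

lemma exists_independent_coloring:
  assumes P: "finite P"
  obtains q c where "c \<in> (P \<rightarrow>\<^sub>E words t) \<rightarrow> words q"
    "\<forall>x \<in> P \<rightarrow>\<^sub>E words t. \<forall>y \<in> P \<rightarrow>\<^sub>E words t. c x = c y \<longrightarrow> distinguishable D P x y"
    "2 ^ q * real (independence_number D P t) \<le> 2 * 2 ^ (t * card P) * (real (t * card P) + 1)"
proof -
  let ?X = "P \<rightarrow>\<^sub>E words t"
  obtain S where S: "independent_tuples D P t S" "card S = independence_number D P t"
    using independence_number_attained[OF P] .
  define K where "K = card S"
  have K0: "K > 0" using S independence_number_pos[OF P] by (simp add: K_def)
  define A where "A z = (\<lambda>x. \<lambda>r\<in>P. xor_word (x r) (z r)) ` S" for z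
  have X: "finite ?X" "?X \<noteq> {}"
    using finite_tuples[OF P] S K0 by (auto simp: independent_tuples_def K_def)
  have SX: "S \<subseteq> ?X" using S by (simp add: independent_tuples_def)
  have many: "K \<le> card {z \<in> ?X. u \<in> A z}" if u: "u \<in> ?X" for u
  proof -
    \<comment> \<open>\<open>?g s\<close> is the translation that carries \<open>s\<close> to
      \<open>u\<close>. It is its own inverse, so the elements of \<open>S\<close> yield distinct
      \<open>z\<close> with \<open>u \<in> A z\<close>.\<close>
    let ?g = "\<lambda>s. \<lambda>r\<in>P. xor_word (u r) (s r)"
    have g: "?g (?g s) = s" "(\<lambda>r\<in>P. xor_word (s r) (?g s r)) = u" if "s \<in> S" for s
    proof -
      have "s \<in> ?X" using that SX by blast
      then show "?g (?g s) = s" "(\<lambda>r\<in>P. xor_word (s r) (?g s r)) = u"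
        using u xor_word_cancel by (auto simp: fun_eq_iff PiE_def extensional_def Pi_def)
    qed
    have "inj_on ?g S" by (rule inj_on_inverseI[of _ ?g]) (rule g)
    then have "K = card (?g ` S)" by (simp add: K_def card_image)
    also have "\<dots> \<le> card {z \<in> ?X. u \<in> A z}"
    proof (rule card_mono)
      show "finite {z \<in> ?X. u \<in> A z}" using X by simp
      show "?g ` S \<subseteq> {z \<in> ?X. u \<in> A z}"
      proof
        fix z assume "z \<in> ?g ` S"
        then obtain s where s: "s \<in> S" "z = ?g s" by blast
        have "z \<in> ?X" using s SX u by (auto simp: xor_word_in_words PiE_def Pi_def subset_eq)
        moreover have "u \<in> A z" unfolding A_def using g(2)[OF s(1)] s by (intro image_eqI) auto
        ultimately show "z \<in> {z \<in> ?X. u \<in> A z}" by simp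
      qed
    qed
    finally show ?thesis .
  qed
  obtain m f where m: "m > 0" "real m \<le> real (card ?X) / K * (ln (card ?X) + 1)"
    and f: "\<And>i::nat. f i \<in> ?X" and cov: "?X \<subseteq> (\<Union>i<m. A (f i))"
    using exists_cover[OF X X K0 many] by blast
  obtain q where q: "m \<le> 2 ^ q" "2 ^ q \<le> 2 * m" using exists_power_two_between[OF m(1)] .
  obtain e where e: "e ` {..<m} \<subseteq> words q" "inj_on e {..<m}"
    using card_le_inj[of "{..<m}" "words q"] q by (auto simp: finite_words card_words)
  \<comment> \<open>The least index singles out one translate when several contain \<open>x\<close>,
    and \<open>e\<close> names it by a word of length \<open>q\<close>. Equal colors then mean a
    common translate.\<close>
  define c where "c x = e (LEAST i. x \<in> A (f i))" for x
  have least: "(LEAST i. x \<in> A (f i)) < m" "x \<in> A (f (LEAST i. x \<in> A (f i)))" if x: "x \<in> ?X" for x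
  proof -
    obtain i where i: "i < m" "x \<in> A (f i)" using cov x by blast
    then show "x \<in> A (f (LEAST i. x \<in> A (f i)))" by (metis LeastI)
    show "(LEAST i. x \<in> A (f i)) < m" using i Least_le[of "\<lambda>i. x \<in> A (f i)" i] by linarith
  qed
  show ?thesis
  proof (rule that)
    show "c \<in> ?X \<rightarrow> words q" using e(1) least(1) by (auto simp: c_def)
    show "\<forall>x\<in>?X. \<forall>y\<in>?X. c x = c y \<longrightarrow> distinguishable D P x y"
    proof (intro ballI impI)
      fix x y assume xy: "x \<in> ?X" "y \<in> ?X" "c x = c y"
      have "(LEAST i. x \<in> A (f i)) = (LEAST i. y \<in> A (f i))"
        using xy least(1) e(2) by (auto simp: c_def inj_on_def)
      then have "x \<in> A (f (LEAST i. x \<in> A (f i)))" "y \<in> A (f (LEAST i. x \<in> A (f i)))"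
        using least(2) xy by metis+
      then show "distinguishable D P x y"
        using independent_translate[OF S(1) f] unfolding A_def independent_tuples_def by blast
    qed
    have "ln (real (card ?X)) = real (t * card P) * ln 2"
      by (simp add: card_tuples[OF P] ln_realpow)
    also have "\<dots> \<le> real (t * card P)" using ln_2_less_1 by (intro mult_left_le) auto
    finally have "real m \<le> 2 ^ (t * card P) / K * (real (t * card P) + 1)"
      using m(2) K0 by (simp add: card_tuples[OF P] divide_right_mono order_trans mult_left_mono)
    then have "real m * K \<le> 2 ^ (t * card P) * (real (t * card P) + 1)"
      using K0 by (simp add: field_simps)
    moreover have "(2::real) ^ q \<le> 2 * m" using q(2) by (metis of_nat_le_iff of_nat_mult of_nat_numeral of_nat_power)
    then have "2 ^ q * real K \<le> 2 * m * K" using mult_right_mono[of "2 ^ q" "2 * real m" K] by simp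
    ultimately show "2 ^ q * real (independence_number D P t)
        \<le> 2 * 2 ^ (t * card P) * (real (t * card P) + 1)"
      using S(2) by (simp add: K_def)
  qed
qed

section \<open>Codes\<close>

text \<open>Decoder-free form of the code condition: what receiver \<open>r\<close> sees determines
  \<open>x r\<close>.\<close>

definition decodable ::
  "nat \<Rightarrow> nat rel \<Rightarrow> nat set \<Rightarrow> nat set \<Rightarrow> nat \<Rightarrow>
   ((nat \<Rightarrow> bool list) \<Rightarrow> bool list) \<Rightarrow> ((nat \<Rightarrow> bool list) \<Rightarrow> bool list) \<Rightarrow> bool" where
  "decodable N D M1 M2 t F1 F2 \<longleftrightarrow>
     (\<forall>x \<in> {1..N} \<rightarrow>\<^sub>E words t. \<forall>y \<in> {1..N} \<rightarrow>\<^sub>E words t. \<forall>r \<in> {1..N}.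
        F1 (restrict x M1) = F1 (restrict y M1) \<longrightarrow> F2 (restrict x M2) = F2 (restrict y M2) \<longrightarrow>
        restrict x (D `` {r}) = restrict y (D `` {r}) \<longrightarrow> x r = y r)"

lemma decodableD:
  assumes "decodable N D M1 M2 t F1 F2"
    and "x \<in> {1..N} \<rightarrow>\<^sub>E words t" "y \<in> {1..N} \<rightarrow>\<^sub>E words t" "r \<in> {1..N}"
    and "F1 (restrict x M1) = F1 (restrict y M1)" "F2 (restrict x M2) = F2 (restrict y M2)"
    and "restrict x (D `` {r}) = restrict y (D `` {r})"
  shows "x r = y r"
  using assms unfolding decodable_def by blast

text \<open>For the converse, the decoder picks any tuple consistent with the codewords and the side
  information; all such tuples agree at \<open>r\<close>, so the choice does not matter.\<close>

lemma exists_decoder_iff: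
  "(\<exists>G. two_sender_index_code N D M1 M2 t p1 p2 F1 F2 G) \<longleftrightarrow>
     F1 \<in> (M1 \<rightarrow>\<^sub>E words t) \<rightarrow> words p1 \<and> F2 \<in> (M2 \<rightarrow>\<^sub>E words t) \<rightarrow> words p2 \<and>
     decodable N D M1 M2 t F1 F2" (is "?L \<longleftrightarrow> ?R")
proof
  assume ?L
  then obtain G where "two_sender_index_code N D M1 M2 t p1 p2 F1 F2 G" by blast
  then show ?R unfolding two_sender_index_code_def decodable_def by metis
next
  assume R: ?R
  let ?same = "\<lambda>r a b w x. x \<in> {1..N} \<rightarrow>\<^sub>E words t \<and> F1 (restrict x M1) = a \<and>
    F2 (restrict x M2) = b \<and> restrict x (D `` {r}) = w"
  let ?G = "\<lambda>r a b w. (SOME x. ?same r a b w x) r"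
  have "?G r (F1 (restrict x M1)) (F2 (restrict x M2)) (restrict x (D `` {r})) = x r"
    if "x \<in> {1..N} \<rightarrow>\<^sub>E words t" "r \<in> {1..N}" for x r
  proof -
    let ?y = "SOME y. ?same r (F1 (restrict x M1)) (F2 (restrict x M2)) (restrict x (D `` {r})) y"
    have "?same r (F1 (restrict x M1)) (F2 (restrict x M2)) (restrict x (D `` {r})) ?y"
      by (rule someI[of _ x]) (use that in simp)
    then show ?thesis using that R by (intro decodableD[of N D M1 M2 t F1 F2 ?y x r]) simp_all
  qed
  then have "two_sender_index_code N D M1 M2 t p1 p2 F1 F2 ?G"
    using R unfolding two_sender_index_code_def by (intro conjI ballI) simp_all
  then show ?L by (intro exI[of _ ?G])
qed

section \<open>Achievable lengths and their subadditivity\<close>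

definition achievable_length :: "nat \<Rightarrow> nat rel \<Rightarrow> nat set \<Rightarrow> nat set \<Rightarrow> nat \<Rightarrow> nat \<Rightarrow> bool" where
  "achievable_length N D M1 M2 t p \<longleftrightarrow>
     (\<exists>p1 p2 F1 F2 G. p = p1 + p2 \<and> two_sender_index_code N D M1 M2 t p1 p2 F1 F2 G)"

lemma achievable_length_iff:
  "achievable_length N D M1 M2 t p \<longleftrightarrow>
   (\<exists>p1 p2 F1 F2. p = p1 + p2 \<and>
     F1 \<in> (M1 \<rightarrow>\<^sub>E words t) \<rightarrow> words p1 \<and> F2 \<in> (M2 \<rightarrow>\<^sub>E words t) \<rightarrow> words p2 \<and>
     decodable N D M1 M2 t F1 F2)"
  unfolding achievable_length_def exists_decoder_iff[symmetric] by blast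

text \<open>Every message is cut into its first \<open>s\<close> and last \<open>t\<close> bits and
  the two codes run side by side, each sender concatenating its two codewords.\<close>

lemma achievable_length_add:
  assumes M: "M1 \<union> M2 = {1..N}" and D: "D \<subseteq> {1..N} \<times> {1..N}"
    and "achievable_length N D M1 M2 s p" "achievable_length N D M1 M2 t q"
  shows "achievable_length N D M1 M2 (s + t) (p + q)"
proof -
  obtain p1 p2 F1 F2 where p: "p = p1 + p2"
    and F: "F1 \<in> (M1 \<rightarrow>\<^sub>E words s) \<rightarrow> words p1" "F2 \<in> (M2 \<rightarrow>\<^sub>E words s) \<rightarrow> words p2"
    and decF: "decodable N D M1 M2 s F1 F2"
    using assms(3) unfolding achievable_length_iff by blast
  obtain q1 q2 H1 H2 where q: "q = q1 + q2"
    and H: "H1 \<in> (M1 \<rightarrow>\<^sub>E words t) \<rightarrow> words q1" "H2 \<in> (M2 \<rightarrow>\<^sub>E words t) \<rightarrow> words q2"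
    and decH: "decodable N D M1 M2 t H1 H2"
    using assms(4) unfolding achievable_length_iff by blast
  define tk where "tk A x = (\<lambda>r\<in>A. take s (x r))" for A :: "nat set" and x :: "nat \<Rightarrow> bool list"
  define dr where "dr A x = (\<lambda>r\<in>A. drop s (x r))" for A :: "nat set" and x :: "nat \<Rightarrow> bool list"
  have tk: "tk A x \<in> A \<rightarrow>\<^sub>E words s" and dr: "dr A x \<in> A \<rightarrow>\<^sub>E words t"
    if "x \<in> A \<rightarrow>\<^sub>E words (s + t)" for A x
    using that by (auto simp: tk_def dr_def words_def PiE_def Pi_def)
  \<comment> \<open>Cutting commutes with restriction, so senders and receivers can cut the messages
    they know on their own.\<close>
  have sub: "tk A (restrict x A) = restrict (tk {1..N} x) A"
    "dr A (restrict x A) = restrict (dr {1..N} x) A" if "A \<subseteq> {1..N}" for A x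
    using that by (auto simp: tk_def dr_def fun_eq_iff)
  have M': "M1 \<subseteq> {1..N}" "M2 \<subseteq> {1..N}" using M by auto
  define E1 where "E1 x = F1 (tk M1 x) @ H1 (dr M1 x)" for x
  define E2 where "E2 x = F2 (tk M2 x) @ H2 (dr M2 x)" for x
  have F': "F1 (tk M1 x) \<in> words p1" "H1 (dr M1 x) \<in> words q1" if "x \<in> M1 \<rightarrow>\<^sub>E words (s + t)" for x
    using that F H tk dr by blast+
  have H': "F2 (tk M2 x) \<in> words p2" "H2 (dr M2 x) \<in> words q2" if "x \<in> M2 \<rightarrow>\<^sub>E words (s + t)" for x
    using that F H tk dr by blast+
  have "x r = y r"
    if x: "x \<in> {1..N} \<rightarrow>\<^sub>E words (s + t)" and y: "y \<in> {1..N} \<rightarrow>\<^sub>E words (s + t)" and r: "r \<in> {1..N}"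
      and E: "E1 (restrict x M1) = E1 (restrict y M1)" "E2 (restrict x M2) = E2 (restrict y M2)"
      and side: "restrict x (D `` {r}) = restrict y (D `` {r})" for x y r
  proof -
    have res: "restrict x M1 \<in> M1 \<rightarrow>\<^sub>E words (s + t)" "restrict y M1 \<in> M1 \<rightarrow>\<^sub>E words (s + t)"
      "restrict x M2 \<in> M2 \<rightarrow>\<^sub>E words (s + t)" "restrict y M2 \<in> M2 \<rightarrow>\<^sub>E words (s + t)"
      using x y M' by (auto simp: PiE_def Pi_def subset_eq)
    note sub1 = sub[OF M'(1)] and sub2 = sub[OF M'(2)]
    \<comment> \<open>The first pieces have a common length, so equal concatenations agree piece by
      piece.\<close>
    have e1: "F1 (restrict (tk {1..N} x) M1) = F1 (restrict (tk {1..N} y) M1)"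
      "H1 (restrict (dr {1..N} x) M1) = H1 (restrict (dr {1..N} y) M1)"
      using E(1) F'[OF res(1)] F'[OF res(2)] unfolding E1_def sub1 words_def by simp_all
    have e2: "F2 (restrict (tk {1..N} x) M2) = F2 (restrict (tk {1..N} y) M2)"
      "H2 (restrict (dr {1..N} x) M2) = H2 (restrict (dr {1..N} y) M2)"
      using E(2) H'[OF res(3)] H'[OF res(4)] unfolding E2_def sub2 words_def by simp_all
    have Dr: "D `` {r} \<subseteq> {1..N}" using D by blast
    have "restrict (tk {1..N} x) (D `` {r}) = restrict (tk {1..N} y) (D `` {r})"
      using sub(1)[OF Dr, of x] sub(1)[OF Dr, of y] side by simp
    from decodableD[OF decF tk[OF x] tk[OF y] r e1(1) e2(1) this]
    have "tk {1..N} x r = tk {1..N} y r" .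
    moreover have "restrict (dr {1..N} x) (D `` {r}) = restrict (dr {1..N} y) (D `` {r})"
      using sub(2)[OF Dr, of x] sub(2)[OF Dr, of y] side by simp
    from decodableD[OF decH dr[OF x] dr[OF y] r e1(2) e2(2) this]
    have "dr {1..N} x r = dr {1..N} y r" .
    ultimately have "take s (x r) = take s (y r)" "drop s (x r) = drop s (y r)"
      using r by (simp_all add: tk_def dr_def)
    then show ?thesis by (metis append_take_drop_id)
  qed
  then have "decodable N D M1 M2 (s + t) E1 E2" unfolding decodable_def by blast
  moreover have "E1 \<in> (M1 \<rightarrow>\<^sub>E words (s + t)) \<rightarrow> words (p1 + q1)"
    using F' by (auto simp: E1_def words_def)
  moreover have "E2 \<in> (M2 \<rightarrow>\<^sub>E words (s + t)) \<rightarrow> words (p2 + q2)"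
    using H' by (auto simp: E2_def words_def)
  ultimately show ?thesis
    unfolding achievable_length_iff p q
    by (intro exI[of _ "p1 + q1"] exI[of _ "p2 + q2"] exI[of _ E1] exI[of _ E2] conjI) auto
qed

text \<open>Repetition keeps the rate of a code while the messages grow, so that a later additive
  loss can be spread over many bits.\<close>

lemma achievable_length_mult:
  assumes "M1 \<union> M2 = {1..N}" "D \<subseteq> {1..N} \<times> {1..N}" "achievable_length N D M1 M2 t p"
  shows "achievable_length N D M1 M2 (Suc k * t) (Suc k * p)"
proof (induction k)
  case (Suc k)
  from achievable_length_add[OF assms Suc] show ?case by simp
qed (use assms in simp)

section \<open>Coding the parts separately\<close>

lemma message_parts_Un:
  assumes "M1 \<union> M2 = {1..N}"
  shows "message_part M1 M2 1 \<union> message_part M1 M2 2 \<union> message_part M1 M2 3 = {1..N}"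
  using assms by (auto simp: message_part_def)

lemma card_message_parts:
  assumes "M1 \<union> M2 = {1..N}"
  shows "card (message_part M1 M2 1) + card (message_part M1 M2 2) + card (message_part M1 M2 3) = N"
proof -
  have fin: "finite M1" "finite M2" using assms by (metis finite_Un finite_atLeastAtMost)+
  have "card (M1 \<union> M2) = card (M1 - M2) + card (M2 - M1) + card (M1 \<inter> M2)"
    using fin by (subst card_Un_disjoint[symmetric], simp_all, blast)
      (subst card_Un_disjoint[symmetric], auto intro!: arg_cong[of _ _ card])
  then show ?thesis using assms by (simp add: message_part_def)
qed

text \<open>Sender 1 sends the colors of parts 1 and 3, sender 2 the color of part 2, so each color
  comes from a sender who knows the part. Decoding uses only arcs of \<open>D\<close> inside a part,
  and \<open>D'\<close> contains these. The three coloring bounds multiply, and the part sizes add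
  up to \<open>N\<close>.\<close>

lemma achievable_length_separate:
  assumes M: "M1 \<union> M2 = {1..N}"
    and D': "\<And>i. i \<in> {1, 2, 3} \<Longrightarrow>
      D \<inter> message_part M1 M2 i \<times> message_part M1 M2 i \<subseteq> D'"
  obtains q where "achievable_length N D' M1 M2 t q"
    "2 ^ q * (real (independence_number D (message_part M1 M2 1) t) *
       real (independence_number D (message_part M1 M2 2) t) *
       real (independence_number D (message_part M1 M2 3) t))
     \<le> 8 * 2 ^ (t * N) * (real (t * N) + 1) ^ 3"
proof -
  let ?P = "message_part M1 M2"
  let ?\<alpha> = "\<lambda>i. real (independence_number D (?P i) t)"
  have fin: "finite M1" "finite M2" using M by (metis finite_Un finite_atLeastAtMost)+
  have finP: "finite (?P i)" for i using fin by (auto simp: message_part_def)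
  obtain q1 c1 where c1: "c1 \<in> (?P 1 \<rightarrow>\<^sub>E words t) \<rightarrow> words q1"
    "\<forall>x \<in> ?P 1 \<rightarrow>\<^sub>E words t. \<forall>y \<in> ?P 1 \<rightarrow>\<^sub>E words t.
      c1 x = c1 y \<longrightarrow> distinguishable D (?P 1) x y"
    "2 ^ q1 * ?\<alpha> 1 \<le> 2 * 2 ^ (t * card (?P 1)) * (real (t * card (?P 1)) + 1)"
    using exists_independent_coloring[OF finP[of 1], where t = t and D = D] by metis
  obtain q2 c2 where c2: "c2 \<in> (?P 2 \<rightarrow>\<^sub>E words t) \<rightarrow> words q2"
    "\<forall>x \<in> ?P 2 \<rightarrow>\<^sub>E words t. \<forall>y \<in> ?P 2 \<rightarrow>\<^sub>E words t.
      c2 x = c2 y \<longrightarrow> distinguishable D (?P 2) x y"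
    "2 ^ q2 * ?\<alpha> 2 \<le> 2 * 2 ^ (t * card (?P 2)) * (real (t * card (?P 2)) + 1)"
    using exists_independent_coloring[OF finP[of 2], where t = t and D = D] by metis
  obtain q3 c3 where c3: "c3 \<in> (?P 3 \<rightarrow>\<^sub>E words t) \<rightarrow> words q3"
    "\<forall>x \<in> ?P 3 \<rightarrow>\<^sub>E words t. \<forall>y \<in> ?P 3 \<rightarrow>\<^sub>E words t.
      c3 x = c3 y \<longrightarrow> distinguishable D (?P 3) x y"
    "2 ^ q3 * ?\<alpha> 3 \<le> 2 * 2 ^ (t * card (?P 3)) * (real (t * card (?P 3)) + 1)"
    using exists_independent_coloring[OF finP[of 3], where t = t and D = D] by metis
  have sub: "?P 1 \<subseteq> M1" "?P 3 \<subseteq> M1" "?P 2 \<subseteq> M2" by (auto simp: message_part_def)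
  have res: "restrict x A \<in> A \<rightarrow>\<^sub>E words t" if "x \<in> B \<rightarrow>\<^sub>E words t" "A \<subseteq> B" for x A B
    using that by (auto simp: PiE_def Pi_def)
  have resres: "restrict (restrict x B) A = restrict x A" if "A \<subseteq> B"
    for x :: "nat \<Rightarrow> bool list" and A B :: "nat set"
    using that by (auto simp: fun_eq_iff restrict_def)
  define F1 where "F1 x = c1 (restrict x (?P 1)) @ c3 (restrict x (?P 3))" for x
  define F2 where "F2 x = c2 (restrict x (?P 2))" for x
  have cw: "c1 (restrict x (?P 1)) \<in> words q1" "c3 (restrict x (?P 3)) \<in> words q3"
    if "x \<in> M1 \<rightarrow>\<^sub>E words t" for x
    using res[OF that sub(1)] res[OF that sub(2)] c1(1) c3(1) by blast+
  have "x r = y r"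
    if x: "x \<in> {1..N} \<rightarrow>\<^sub>E words t" and y: "y \<in> {1..N} \<rightarrow>\<^sub>E words t" and r: "r \<in> {1..N}"
      and F: "F1 (restrict x M1) = F1 (restrict y M1)" "F2 (restrict x M2) = F2 (restrict y M2)"
      and side: "restrict x (D' `` {r}) = restrict y (D' `` {r})" for x y r
  proof -
    have M': "M1 \<subseteq> {1..N}" "M2 \<subseteq> {1..N}" using M by auto
    then have P': "?P 1 \<subseteq> {1..N}" "?P 2 \<subseteq> {1..N}" "?P 3 \<subseteq> {1..N}" using sub by auto
    have "c1 (restrict x (?P 1)) = c1 (restrict y (?P 1)) \<and>
          c3 (restrict x (?P 3)) = c3 (restrict y (?P 3))"
      using F(1) cw[OF res[OF x M'(1)]] cw[OF res[OF y M'(1)]]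
      unfolding F1_def words_def resres[OF sub(1)] resres[OF sub(2)] by simp
    moreover have "c2 (restrict x (?P 2)) = c2 (restrict y (?P 2))"
      using F(2) unfolding F2_def resres[OF sub(3)] .
    ultimately have "distinguishable D (?P 1) (restrict x (?P 1)) (restrict y (?P 1))"
      "distinguishable D (?P 2) (restrict x (?P 2)) (restrict y (?P 2))"
      "distinguishable D (?P 3) (restrict x (?P 3)) (restrict y (?P 3))"
      using c1(2) c2(2) c3(2) res[OF x P'(1)] res[OF y P'(1)] res[OF x P'(2)] res[OF y P'(2)]
        res[OF x P'(3)] res[OF y P'(3)] by blast+
    then have dist: "distinguishable D (?P i) x y" if "i \<in> {1, 2, 3}" for i
      using that unfolding distinguishable_restrict by blast
    from r obtain i where i: "i \<in> {1, 2, 3}" "r \<in> ?P i"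
      unfolding message_parts_Un[OF M, symmetric] by blast
    have "x s = y s" if "s \<in> ?P i" "(r, s) \<in> D" for s
    proof -
      have "s \<in> D' `` {r}" using D'[OF i(1)] that i(2) by auto
      with side show ?thesis by (metis restrict_apply')
    qed
    then show ?thesis using dist[OF i(1)] i(2) by (auto simp: distinguishable_def)
  qed
  then have "decodable N D' M1 M2 t F1 F2" unfolding decodable_def by blast
  moreover have "F1 \<in> (M1 \<rightarrow>\<^sub>E words t) \<rightarrow> words (q1 + q3)"
    using cw by (auto simp: F1_def words_def)
  moreover have "F2 \<in> (M2 \<rightarrow>\<^sub>E words t) \<rightarrow> words q2"
    unfolding F2_def using funcset_mem[OF c2(1) res[OF _ sub(3)]] by blast
  ultimately have ach: "achievable_length N D' M1 M2 t (q1 + q3 + q2)"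
    unfolding achievable_length_iff
    by (intro exI[of _ "q1 + q3"] exI[of _ q2] exI[of _ F1] exI[of _ F2] conjI) auto
  let ?n = "\<lambda>i. card (?P i)"
  have n: "?n 1 + ?n 2 + ?n 3 = N" using card_message_parts[OF M] .
  \<comment> \<open>All three linear factors are enlarged to \<open>t * N + 1\<close>, so that their
    product becomes a cube.\<close>
  have b: "a \<le> 2 * 2 ^ (t * k) * (real (t * N) + 1)"
    if "a \<le> 2 * 2 ^ (t * k) * (real (t * k) + 1)" "k \<le> N" for a :: real and k
  proof -
    have "real (t * k) \<le> real (t * N)" using that(2) by (intro of_nat_mono mult_le_mono2)
    then have "2 * 2 ^ (t * k) * (real (t * k) + 1) \<le> 2 * 2 ^ (t * k) * (real (t * N) + 1)"
      by (intro mult_left_mono) auto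
    with that(1) show ?thesis by (rule order_trans)
  qed
  have "2 ^ (q1 + q3 + q2) * (?\<alpha> 1 * ?\<alpha> 2 * ?\<alpha> 3)
      = (2 ^ q1 * ?\<alpha> 1) * (2 ^ q2 * ?\<alpha> 2) * (2 ^ q3 * ?\<alpha> 3)"
    by (simp add: power_add)
  also have "\<dots> \<le> (2 * 2 ^ (t * ?n 1) * (real (t * N) + 1)) *
      (2 * 2 ^ (t * ?n 2) * (real (t * N) + 1)) * (2 * 2 ^ (t * ?n 3) * (real (t * N) + 1))"
    by (intro mult_mono[OF mult_mono[OF b b] b] c1(3) c2(3) c3(3)) (use n in auto)
  also have "\<dots> = 8 * 2 ^ (t * (?n 1 + ?n 2 + ?n 3)) * (real (t * N) + 1) ^ 3"
    unfolding add_mult_distrib2 power_add power3_eq_cube by algebra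
  finally show ?thesis using that[OF ach] n by simp
qed

section \<open>The lower bound\<close>

text \<open>The tuples split by codeword pair into at most \<open>2 ^ (p1 + p2)\<close> classes,
  each bounded by the count part after part. \<open>P\<close>, \<open>Q\<close>, \<open>R\<close> is
  the order in which the parts are fixed.\<close>

lemma pow_le_prod_independence_numbers:
  assumes M: "M1 \<union> M2 = {1..N}"
    and PQR: "P \<union> Q \<union> R = {1..N}"
    and F: "F1 \<in> (M1 \<rightarrow>\<^sub>E words t) \<rightarrow> words p1" "F2 \<in> (M2 \<rightarrow>\<^sub>E words t) \<rightarrow> words p2"
    and step: "\<And>x y A. x \<in> {1..N} \<rightarrow>\<^sub>E words t \<Longrightarrow> y \<in> {1..N} \<rightarrow>\<^sub>E words t \<Longrightarrow>
      F1 (restrict x M1) = F1 (restrict y M1) \<Longrightarrow> F2 (restrict x M2) = F2 (restrict y M2) \<Longrightarrow>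
      (A = P \<or> A = Q \<and> (\<forall>s\<in>P. x s = y s) \<or> A = R \<and> (\<forall>s\<in>P \<union> Q. x s = y s)) \<Longrightarrow>
      distinguishable D A x y"
  shows "2 ^ (t * N) \<le> 2 ^ (p1 + p2) *
    (independence_number D P t * independence_number D Q t * independence_number D R t)"
proof -
  let ?X = "{1..N} \<rightarrow>\<^sub>E words t"
  let ?E = "\<lambda>x. (F1 (restrict x M1), F2 (restrict x M2))"
  let ?b = "independence_number D P t * independence_number D Q t * independence_number D R t"
  have "M1 \<subseteq> {1..N}" "M2 \<subseteq> {1..N}" using M by auto
  then have "restrict x M1 \<in> M1 \<rightarrow>\<^sub>E words t" "restrict x M2 \<in> M2 \<rightarrow>\<^sub>E words t" if "x \<in> ?X" for x
    using that by (auto simp: PiE_def Pi_def subset_eq)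
  then have E: "?E \<in> ?X \<rightarrow> words p1 \<times> words p2" using F by blast
  have "?X = (\<Union>c\<in>words p1 \<times> words p2. {x \<in> ?X. ?E x = c})" using E by auto
  then have "card ?X \<le> (\<Sum>c\<in>words p1 \<times> words p2. card {x \<in> ?X. ?E x = c})"
    using card_UN_le[of "words p1 \<times> words p2" "\<lambda>c. {x \<in> ?X. ?E x = c}"] finite_words by simp
  also have "\<dots> \<le> (\<Sum>c\<in>words p1 \<times> words p2. ?b)"
    using PQR by (intro sum_mono card_le_prod_independence_numbers step) auto
  also have "\<dots> = 2 ^ (p1 + p2) * ?b" by (simp add: card_cartesian_product card_words power_add)
  finally show ?thesis using card_tuples[of "{1..N}" t] by simp
qed

text \<open>A part contributes only its own independence number once every part its arcs lead to is
  fixed. An acyclic interaction digraph admits an order respecting this; if part 3 has no outgoing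
  arcs, the order 3, 2, 1 works because part 1 can be exchanged without changing the codeword of the
  second sender.\<close>

lemma achievable_length_lower_bound:
  assumes D: "D \<subseteq> {1..N} \<times> {1..N}" and M: "M1 \<union> M2 = {1..N}"
    and f: "acyclic (interaction_digraph D M1 M2) \<or>
         (\<forall>k. (3, k) \<notin> interaction_digraph D M1 M2)"
    and ach: "achievable_length N D M1 M2 t p"
  shows "2 ^ (t * N) \<le> 2 ^ p * (independence_number D (message_part M1 M2 1) t *
    independence_number D (message_part M1 M2 2) t * independence_number D (message_part M1 M2 3) t)"
proof -
  let ?P = "message_part M1 M2"
  let ?I = "interaction_digraph D M1 M2"
  obtain p1 p2 F1 F2 where p: "p = p1 + p2"
    and F: "F1 \<in> (M1 \<rightarrow>\<^sub>E words t) \<rightarrow> words p1" "F2 \<in> (M2 \<rightarrow>\<^sub>E words t) \<rightarrow> words p2"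
    and dec: "decodable N D M1 M2 t F1 F2"
    using ach unfolding achievable_length_iff by blast
  have U: "?P 1 \<union> ?P 2 \<union> ?P 3 = {1..N}" using message_parts_Un[OF M] .
  \<comment> \<open>Agreement on the parts that part \<open>i\<close> points to supplies all side
    information from outside, so decodability becomes distinguishability inside part
    \<open>i\<close>.\<close>
  have dist: "distinguishable D (?P i) x y"
    if xy: "x \<in> {1..N} \<rightarrow>\<^sub>E words t" "y \<in> {1..N} \<rightarrow>\<^sub>E words t"
        "F1 (restrict x M1) = F1 (restrict y M1)" "F2 (restrict x M2) = F2 (restrict y M2)"
      and i: "i \<in> {1, 2, 3}" and eq: "\<And>j s. j \<noteq> i \<Longrightarrow> (i, j) \<in> ?I \<Longrightarrow> s \<in> ?P j \<Longrightarrow> x s = y s"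
    for i x y
    unfolding distinguishable_def
  proof (intro ballI impI)
    fix r assume r: "r \<in> ?P i" and own: "\<forall>s\<in>?P i. (r, s) \<in> D \<longrightarrow> x s = y s"
    have "x s = y s" if "(r, s) \<in> D" for s
    proof -
      have "s \<in> ?P 1 \<union> ?P 2 \<union> ?P 3" unfolding U using that D by blast
      then obtain j where j: "j \<in> {1, 2, 3}" "s \<in> ?P j" by blast
      show ?thesis
      proof (cases "j = i")
        case False
        then have "(i, j) \<in> ?I" using i j r that by (auto simp: interaction_digraph_def)
        then show ?thesis using eq False j by blast
      qed (use own that j in auto)
    qed
    then have "restrict x (D `` {r}) = restrict y (D `` {r})" by (auto simp: fun_eq_iff restrict_def)
    moreover have "r \<in> {1..N}" unfolding U[symmetric] using r i by blast
    ultimately show "x r = y r" using decodableD[OF dec xy(1,2) _ xy(3,4)] by blast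
  qed
  show ?thesis
    using f
  proof
    assume acyc: "acyclic ?I"
    \<comment> \<open>On three vertices without loops, only cycles of length 2 and 3 have to be
      excluded.\<close>
    have c2: "\<not> ((a, b) \<in> ?I \<and> (b, a) \<in> ?I)" for a b
      using acyc unfolding acyclic_def by (meson r_into_trancl' trancl_trans)
    have c3: "\<not> ((a, b) \<in> ?I \<and> (b, c) \<in> ?I \<and> (c, a) \<in> ?I)" for a b c
      using acyc unfolding acyclic_def by (meson r_into_trancl' trancl_trans)
    have irr: "(a, a) \<notin> ?I" for a by (simp add: interaction_digraph_def)
    \<comment> \<open>No arc leads from an earlier to a later part in the order \<open>a\<close>,
      \<open>b\<close>, \<open>c\<close>, so whatever a part points to is fixed before it.\<close>
    have ordered: ?thesis
      if abc: "{a, b, c} = {1, 2, 3}" "a \<noteq> b" "b \<noteq> c" "a \<noteq> c"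
        and no: "(a, b) \<notin> ?I" "(a, c) \<notin> ?I" "(b, c) \<notin> ?I" for a b c
    proof -
      have mem: "j \<in> {a, b, c}" if "(i, j) \<in> ?I" for i j
        using that abc(1) by (auto simp: interaction_digraph_def)
      have in3: "a \<in> {1, 2, 3}" "b \<in> {1, 2, 3}" "c \<in> {1, 2, 3}" using abc(1) by auto
      have "?P a \<union> ?P b \<union> ?P c = \<Union> (?P ` {a, b, c})" by auto
      also have "\<dots> = {1..N}" unfolding abc(1) using U by auto
      finally have U': "?P a \<union> ?P b \<union> ?P c = {1..N}" .
      have "2 ^ (t * N) \<le> 2 ^ (p1 + p2) * (independence_number D (?P a) t *
          independence_number D (?P b) t * independence_number D (?P c) t)"
      proof (rule pow_le_prod_independence_numbers[OF M U' F])
        fix x y A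
        assume xy: "x \<in> {1..N} \<rightarrow>\<^sub>E words t" "y \<in> {1..N} \<rightarrow>\<^sub>E words t"
          "F1 (restrict x M1) = F1 (restrict y M1)" "F2 (restrict x M2) = F2 (restrict y M2)"
          and A: "A = ?P a \<or> A = ?P b \<and> (\<forall>s\<in>?P a. x s = y s) \<or>
            A = ?P c \<and> (\<forall>s\<in>?P a \<union> ?P b. x s = y s)"
        from A show "distinguishable D A x y"
        proof (elim disjE conjE)
          assume "A = ?P a"
          then show ?thesis using dist[OF xy in3(1)] mem no irr by blast
        next
          assume "A = ?P b" "\<forall>s\<in>?P a. x s = y s"
          then show ?thesis using dist[OF xy in3(2)] mem no irr by blast
        next
          assume "A = ?P c" "\<forall>s\<in>?P a \<union> ?P b. x s = y s"
          then show ?thesis using dist[OF xy in3(3)] mem no irr by blast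
        qed
      qed
      moreover have "independence_number D (?P a) t * independence_number D (?P b) t *
          independence_number D (?P c) t = (\<Prod>i\<in>{a, b, c}. independence_number D (?P i) t)"
        using abc(2-4) by (simp add: mult.assoc)
      moreover have "independence_number D (?P 1) t * independence_number D (?P 2) t *
          independence_number D (?P 3) t = (\<Prod>i\<in>{1, 2, 3}. independence_number D (?P i) t)"
        by (simp add: mult.assoc)
      ultimately show ?thesis unfolding p abc(1) by (simp only:)
    qed
    have perms: "{1, 2, 3} = {1, 2, 3::nat}" "{1, 3, 2} = {1, 2, 3::nat}" "{2, 1, 3} = {1, 2, 3::nat}"
      "{2, 3, 1} = {1, 2, 3::nat}" "{3, 1, 2} = {1, 2, 3::nat}" "{3, 2, 1} = {1, 2, 3::nat}"
      by auto
    \<comment> \<open>Without 2-cycles and 3-cycles at least one of the six orders is admissible,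
      which is a propositional fact about the six possible arcs.\<close>
    show ?thesis
      using ordered[OF perms(1)] ordered[OF perms(2)] ordered[OF perms(3)] ordered[OF perms(4)]
        ordered[OF perms(5)] ordered[OF perms(6)] c2[of 1 2] c2[of 1 3] c2[of 2 3]
        c3[of 1 2 3] c3[of 1 3 2]
      by simp argo
  next
    assume no3: "\<forall>k. (3, k) \<notin> ?I"
    have U': "?P 3 \<union> ?P 2 \<union> ?P 1 = {1..N}" using U by auto
    have "2 ^ (t * N) \<le> 2 ^ (p1 + p2) * (independence_number D (?P 3) t *
        independence_number D (?P 2) t * independence_number D (?P 1) t)"
    proof (rule pow_le_prod_independence_numbers[OF M U' F])
      fix x y A
      assume xy: "x \<in> {1..N} \<rightarrow>\<^sub>E words t" "y \<in> {1..N} \<rightarrow>\<^sub>E words t"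
        "F1 (restrict x M1) = F1 (restrict y M1)" "F2 (restrict x M2) = F2 (restrict y M2)"
        and A: "A = ?P 3 \<or> A = ?P 2 \<and> (\<forall>s\<in>?P 3. x s = y s) \<or>
          A = ?P 1 \<and> (\<forall>s\<in>?P 3 \<union> ?P 2. x s = y s)"
      from A show "distinguishable D A x y"
      proof (elim disjE conjE)
        assume "A = ?P 3"
        then show ?thesis using dist[OF xy, of 3] no3 by auto
      next
        assume A: "A = ?P 2" and x3: "\<forall>s\<in>?P 3. x s = y s"
        \<comment> \<open>With \<open>x\<^sub>3\<close> fixed, the codeword of \<open>S\<^sub>1\<close> does not change if \<open>y\<^sub>1\<close> is replaced by \<open>x\<^sub>1\<close>.\<close>
        define y' where "y' s = (if s \<in> ?P 1 then x s else y s)" for s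
        have y': "y' \<in> {1..N} \<rightarrow>\<^sub>E words t"
          using xy(1,2) U by (auto simp: y'_def PiE_def Pi_def extensional_def)
        have "restrict y' M1 = restrict x M1" "restrict y' M2 = restrict y M2"
          using x3 by (auto simp: y'_def fun_eq_iff restrict_def message_part_def)
        \<comment> \<open>\<open>x\<close> and \<open>y'\<close> have the same codewords and agree
          on parts 1 and 3, hence on everything outside part 2. On part 2 itself \<open>y'\<close>
          is \<open>y\<close>.\<close>
        then have "distinguishable D (?P 2) x y'"
          using xy x3 y'
          by (intro dist) (auto simp: interaction_digraph_def y'_def message_part_def split: if_splits)
        then have "distinguishable D (?P 2) x y"
          by (auto simp: distinguishable_def y'_def message_part_def)
        then show ?thesis using A by simp
      next
        assume "A = ?P 1" "\<forall>s\<in>?P 3 \<union> ?P 2. x s = y s"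
        then show ?thesis using dist[OF xy, of 1] by (auto simp: interaction_digraph_def)
      qed
    qed
    then show ?thesis using p by (simp add: mult_ac)
  qed
qed

section \<open>Broadcast rates\<close>

lemma broadcast_rate_t_eq:
  "broadcast_rate_t N D M1 M2 t = real (LEAST p. achievable_length N D M1 M2 t p) / real t"
  by (simp add: broadcast_rate_t_def achievable_length_def)

lemma broadcast_rate_le:
  assumes "achievable_length N D M1 M2 t q" "t > 0"
  shows "broadcast_rate N D M1 M2 \<le> real q / real t"
proof -
  have "broadcast_rate N D M1 M2 \<le> broadcast_rate_t N D M1 M2 t"
    unfolding broadcast_rate_def using assms(2)
    by (intro cINF_lower bdd_belowI2[where m = 0]) (auto simp: broadcast_rate_t_eq)
  also have "\<dots> \<le> real q / real t"
    unfolding broadcast_rate_t_eq using assms by (intro divide_right_mono of_nat_mono Least_le) auto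
  finally show ?thesis .
qed

text \<open>The upper and the lower bound share the product of the independence numbers, which is
  positive and cancels. Logarithms turn the factor 8 into 3 and the cube into the coefficient
  3.\<close>

lemma achievable_length_loss:
  assumes D: "D \<subseteq> {1..N} \<times> {1..N}" and M: "M1 \<union> M2 = {1..N}"
    and f: "acyclic (interaction_digraph D M1 M2) \<or>
         (\<forall>k. (3, k) \<notin> interaction_digraph D M1 M2)"
    and D': "\<And>i. i \<in> {1, 2, 3} \<Longrightarrow>
      D \<inter> message_part M1 M2 i \<times> message_part M1 M2 i \<subseteq> D'"
    and ach: "achievable_length N D M1 M2 t p"
  obtains q where "achievable_length N D' M1 M2 t q"
    "real q \<le> real p + 3 + 3 * log 2 (real t * real N + 1)"
proof -
  let ?\<alpha> = "\<lambda>i. independence_number D (message_part M1 M2 i) t"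
  let ?a = "real (?\<alpha> 1) * real (?\<alpha> 2) * real (?\<alpha> 3)"
  obtain q where q: "achievable_length N D' M1 M2 t q"
    "2 ^ q * ?a \<le> 8 * 2 ^ (t * N) * (real (t * N) + 1) ^ 3"
    using achievable_length_separate[OF M D'] by blast
  have "finite M1" "finite M2" using M by (metis finite_Un finite_atLeastAtMost)+
  then have "?a > 0" by (simp add: independence_number_pos message_part_def)
  have "real (2 ^ (t * N)) \<le> real (2 ^ p * (?\<alpha> 1 * ?\<alpha> 2 * ?\<alpha> 3))"
    using achievable_length_lower_bound[OF D M f ach] by (rule of_nat_mono)
  then have "2 ^ (t * N) \<le> 2 ^ p * ?a" by simp
  then have "8 * 2 ^ (t * N) * (real (t * N) + 1) ^ 3 \<le> 8 * (2 ^ p * ?a) * (real (t * N) + 1) ^ 3"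
    by (intro mult_right_mono mult_left_mono) auto
  with q(2) have "2 ^ q * ?a \<le> (8 * 2 ^ p * (real (t * N) + 1) ^ 3) * ?a" by (simp add: mult_ac)
  then have "2 ^ q \<le> 8 * 2 ^ p * (real (t * N) + 1) ^ 3"
    using \<open>?a > 0\<close> by (rule mult_right_le_imp_le)
  then have "log 2 (2 ^ q) \<le> log 2 (8 * 2 ^ p * (real (t * N) + 1) ^ 3)" by (intro log_mono) auto
  also have "\<dots> = real p + 3 + 3 * log 2 (real t * real N + 1)"
  proof -
    have "real t * real N + 1 > 0" by (simp add: add_nonneg_pos)
    moreover have "log 2 8 = (3 :: real)" using log_pow_cancel[of 2 3] by simp
    ultimately show ?thesis by (simp add: log_mult log_nat_power)
  qed
  finally show ?thesis using that q(1) by (simp add: log_nat_power)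
qed

text \<open>An optimal code for \<open>D\<close> is repeated \<open>k + 1\<close> times before its
  length is compared with that of a code for \<open>D'\<close>. Divided by the message length
  \<open>(k + 1) * t\<close>, the logarithmic loss tends to 0.\<close>

lemma broadcast_rate_cross_arcs_le:
  assumes D: "D \<subseteq> {1..N} \<times> {1..N}" and M: "M1 \<union> M2 = {1..N}"
    and f: "acyclic (interaction_digraph D M1 M2) \<or>
         (\<forall>k. (3, k) \<notin> interaction_digraph D M1 M2)"
    and D': "\<And>i. i \<in> {1, 2, 3} \<Longrightarrow>
      D \<inter> message_part M1 M2 i \<times> message_part M1 M2 i \<subseteq> D'"
  shows "broadcast_rate N D' M1 M2 \<le> broadcast_rate N D M1 M2"
proof -
  have "broadcast_rate N D' M1 M2 \<le> broadcast_rate_t N D M1 M2 t" if t: "t \<ge> 1" for t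
  proof -
    define p where "p = (LEAST p. achievable_length N D M1 M2 t p)"
    \<comment> \<open>Coding the parts separately for \<open>D\<close> itself shows that some length
      is achievable, so the minimum is attained.\<close>
    have "\<exists>p. achievable_length N D M1 M2 t p"
      using achievable_length_separate[OF M, of D D] by blast
    then have p: "achievable_length N D M1 M2 t p" unfolding p_def by (rule LeastI_ex)
    \<comment> \<open>\<open>y\<close> stands for the message length \<open>(k + 1) * t\<close>.
      Writing \<open>N + 1\<close> for \<open>N\<close> keeps the coefficient inside the logarithm
      positive even for \<open>N = 0\<close>, as the limit below asks.\<close>
    define h where "h y = real p / real t + (3 + 3 * log 2 ((real N + 1) * y + 1)) / y" for y
    have bound: "broadcast_rate N D' M1 M2 \<le> h (real (Suc k) * real t)" for k
    proof -
      obtain q where q: "achievable_length N D' M1 M2 (Suc k * t) q"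
        "real q \<le> real (Suc k * p) + 3 + 3 * log 2 (real (Suc k * t) * real N + 1)"
        using achievable_length_loss[OF D M f D' achievable_length_mult[OF M D p]] by blast
      let ?y = "real (Suc k) * real t"
      have y: "?y > 0" using t by simp
      have "log 2 (?y * real N + 1) \<le> log 2 ((real N + 1) * ?y + 1)"
        using y by (intro log_mono add_nonneg_pos) (auto simp: algebra_simps)
      with q(2) have "real q \<le> real (Suc k) * real p + (3 + 3 * log 2 ((real N + 1) * ?y + 1))"
        by (simp only: of_nat_mult)
      then have "real q / ?y \<le> (real (Suc k) * real p + (3 + 3 * log 2 ((real N + 1) * ?y + 1))) / ?y"
        using y by (intro divide_right_mono) auto
      also have "\<dots> = h ?y" using t by (simp only: h_def add_divide_distrib) simp
      finally have "real q / ?y \<le> h ?y" .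
      moreover have "broadcast_rate N D' M1 M2 \<le> real q / ?y"
        using broadcast_rate_le[OF q(1)] t by (simp add: of_nat_mult del: of_nat_Suc mult_Suc)
      ultimately show ?thesis by (rule order_trans[rotated])
    qed
    have "((\<lambda>y. a + (3 + 3 * log 2 (c * y + 1)) / y) \<longlongrightarrow> a) at_top" if "c > 0" for a c :: real
      using that by real_asymp
    then have "(h \<longlongrightarrow> real p / real t) at_top" unfolding h_def by simp
    moreover have "filterlim (\<lambda>k. real (Suc k) * real t) at_top sequentially"
      using t by real_asymp
    ultimately have "(\<lambda>k. h (real (Suc k) * real t)) \<longlonglongrightarrow> real p / real t"
      by (rule filterlim_compose)
    then have "broadcast_rate N D' M1 M2 \<le> real p / real t"
      using bound by (intro LIMSEQ_le_const) auto
    then show ?thesis by (simp add: broadcast_rate_t_eq p_def)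
  qed
  then show ?thesis unfolding broadcast_rate_def[of N D] by (intro cINF_greatest) auto
qed

theorem corollary1:
  fixes N :: nat and D :: "nat rel" and M1 M2 :: "nat set" and i j u v :: nat
  assumes "D \<subseteq> {1..N} \<times> {1..N}" and "irrefl D"
    and "M1 \<union> M2 = {1..N}"
    and "acyclic (interaction_digraph D M1 M2) \<or>
         (\<forall>k. (3, k) \<notin> interaction_digraph D M1 M2)"
    and "i \<in> {1, 2, 3}" and "j \<in> {1, 2, 3}" and "i \<noteq> j"
    and "u \<in> message_part M1 M2 i" and "v \<in> message_part M1 M2 j" and "(u, v) \<in> D"
  shows "\<not> critical_arc N D M1 M2 (u, v)"
proof -
  \<comment> \<open>The parts are disjoint, so no arc inside a part is the removed arc, whose ends
    lie in different parts.\<close>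
  have "D \<inter> message_part M1 M2 k \<times> message_part M1 M2 k \<subseteq> D - {(u, v)}" for k
    using assms(7-9) by (auto simp: message_part_def split: if_splits)
  then have "broadcast_rate N (D - {(u, v)}) M1 M2 \<le> broadcast_rate N D M1 M2"
    by (intro broadcast_rate_cross_arcs_le assms)
  then show ?thesis by (simp add: critical_arc_def)
qed

end
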